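(* Let $A\in\mathbb{R}^{n\times d}$, let $1\le k\le \operatorname{rank}(A)$, and let $\epsilon>0$. Let $A_k$, $A_{\setminus k}$ and $V_k$ be given by the head-tail split of $A$ at $k$. Suppose $S\in\mathbb{R}^{d\times m}$ satisfies: 1. $S$ is an $\frac{\epsilon}{3}$-subspace embedding for $A_k$; 2. $S$ satisfies $\frac{\epsilon}{6\sqrt{k}}$-approximate matrix multiplication for the pair $A_{\setminus k}, A_{\setminus k}^T$, i.e. $\|A_{\setminus k}A_{\setminus k}^T-A_{\setminus k}SS^TA_{\setminus k}^T\|_F\le \frac{\epsilon}{6\sqrt k}\|A_{\setminus k}\|_F^2$; 3. $S$ satisfies $\frac{\epsilon}{6\sqrt{k}}$-approximate matrix multiplication for the pair $A_{\setminus k}, V_k$, i.e. $\|A_{\setminus k}V_k-A_{\setminus k}SS^TV_k\|_F\le \frac{\epsilon}{6\sqrt k}\|A_{\setminus k}\|_F\|V_k\|_F$; 4. $S$ satisfies $\frac{\epsilon}{6}$-Frobenius norm preservation for $A_{\setminus k}$. Then $\tilde A=AS$ is an $(\epsilon,0,k)$-projection-cost-preserving sketch of $A$.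
   Context: $\|\cdot\|_F$ is the Frobenius norm. Projection-cost-preserving sketch. $\tilde A\in\mathbb{R}^{n\times m}$ is an $(\epsilon,c,k)$-projection-cost-preserving sketch of $A\in\mathbb{R}^{n\times d}$ if, for every orthogonal projection matrix $P\in\mathbb{R}^{n\times n}$ with rank at most $k$, $(1-\epsilon)\|A-PA\|_F^2\le \|\tilde A-P\tilde A\|_F^2+c\le (1+\epsilon)\|A-PA\|_F^2$, where $c$ is a constant independent of $P$. Subspace embedding. $S\in\mathbb{R}^{d\times m}$ is an $\epsilon$-subspace embedding for $M\in\mathbb{R}^{n\times d}$ if for all $x\in\mathbb{R}^n$, $\left|\|x^TM\|_2^2-\|x^TMS\|_2^2\right|\le\epsilon\|x^TM\|_2^2$. Approximate matrix multiplication. $S\in\mathbb{R}^{d\times m}$ satisfies $\epsilon$-approximate matrix multiplication for $M\in\mathbb{R}^{n\times d}$, $N\in\mathbb{R}^{d\times p}$ if $\|MN-MSS^TN\|_F\le\epsilon\|M\|_F\|N\|_F$. Frobenius norm preservation. $S\in\mathbb{R}^{d\times m}$ satisfies $\epsilon$-Frobenius norm preservation for $M\in\mathbb{R}^{n\times d}$ if $\left|\|M\|_F^2-\|MS\|_F^2\right|\le\epsilon\|M\|_F^2$. Head-tail split. Let $M=U\Sigma V^T$ be the (compact) singular value decomposition of $M\in\mathbb{R}^{n\times d}$, with $U\in\mathbb{R}^{n\times\operatorname{rank}(M)}$, $V\in\mathbb{R}^{d\times\operatorname{rank}(M)}$ having orthonormal columns and $\Sigma$ diagonal with entries $\sigma_1\ge\sigma_2\ge\dots\ge\sigma_{\operatorname{rank}(M)}>0$.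 For $r\le\operatorname{rank}(M)$, $U_r,V_r$ denote the first $r$ columns of $U,V$, $M_r=U_rU_r^TM=MV_rV_r^T$, and $M_{\setminus r}=M-M_r$. *)

theory Defs
  imports Complex_Main "Jordan_Normal_Form.DL_Rank"
begin

definition frob_norm :: "real mat \<Rightarrow> real" where
  "frob_norm M = sqrt (\<Sum>i<dim_row M. \<Sum>j<dim_col M. (M $$ (i, j))\<^sup>2)"

definition l2_norm :: "real vec \<Rightarrow> real" where
  "l2_norm v = sqrt (v \<bullet> v)"

abbreviation mat_rank :: "real mat \<Rightarrow> nat" where
  "mat_rank M \<equiv> vec_space.rank (dim_row M) M"

definition orthogonal_projection_mat :: "nat \<Rightarrow> real mat \<Rightarrow> bool" where
  "orthogonal_projection_mat n P \<longleftrightarrow>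
     P \<in> carrier_mat n n \<and> P * P = P \<and> transpose_mat P = P"

text \<open>The constant \<open>c\<close> is a parameter, hence the same for every projection \<open>P\<close>.
  A sketch has as many rows as \<open>A\<close>; its number of columns is arbitrary.\<close>

definition projection_cost_preserving_sketch ::
    "real \<Rightarrow> real \<Rightarrow> nat \<Rightarrow> real mat \<Rightarrow> real mat \<Rightarrow> bool" where
  "projection_cost_preserving_sketch \<epsilon> c k A A' \<longleftrightarrow>
     dim_row A' = dim_row A \<and>
     (\<forall>P. orthogonal_projection_mat (dim_row A) P \<and> mat_rank P \<le> k \<longrightarrow>
        (1 - \<epsilon>) * (frob_norm (A - P * A))\<^sup>2 \<le> (frob_norm (A' - P * A'))\<^sup>2 + c \<and>
        (frob_norm (A' - P * A'))\<^sup>2 + c \<le> (1 + \<epsilon>) * (frob_norm (A - P * A))\<^sup>2)"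

text \<open>The row vector \<open>x\<^sup>T M\<close> is represented by the vector \<open>M\<^sup>T x\<close>.\<close>

definition subspace_embedding :: "real \<Rightarrow> real mat \<Rightarrow> real mat \<Rightarrow> bool" where
  "subspace_embedding \<epsilon> M S \<longleftrightarrow>
     dim_row S = dim_col M \<and>
     (\<forall>x \<in> carrier_vec (dim_row M).
        \<bar>(l2_norm (transpose_mat M *\<^sub>v x))\<^sup>2 - (l2_norm (transpose_mat (M * S) *\<^sub>v x))\<^sup>2\<bar>
          \<le> \<epsilon> * (l2_norm (transpose_mat M *\<^sub>v x))\<^sup>2)"

definition approx_mat_mult :: "real \<Rightarrow> real mat \<Rightarrow> real mat \<Rightarrow> real mat \<Rightarrow> bool" where
  "approx_mat_mult \<epsilon> M N S \<longleftrightarrow>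
     dim_row N = dim_col M \<and> dim_row S = dim_col M \<and>
     frob_norm (M * N - M * S * transpose_mat S * N) \<le> \<epsilon> * frob_norm M * frob_norm N"

definition frob_norm_preservation :: "real \<Rightarrow> real mat \<Rightarrow> real mat \<Rightarrow> bool" where
  "frob_norm_preservation \<epsilon> M S \<longleftrightarrow>
     dim_row S = dim_col M \<and>
     \<bar>(frob_norm M)\<^sup>2 - (frob_norm (M * S))\<^sup>2\<bar> \<le> \<epsilon> * (frob_norm M)\<^sup>2"

text \<open>A compact singular value decomposition is not unique (repeated singular values), so it is a
  relation between \<open>M\<close> and the three factors.  With indices from 0, the entry \<open>(i, i)\<close> of \<open>\<Sigma>\<close>
  is the singular value \<open>\<sigma>\<close> of index \<open>i + 1\<close>.\<close>

definition compact_svd :: "real mat \<Rightarrow> real mat \<Rightarrow> real mat \<Rightarrow> real mat \<Rightarrow> bool" where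
  "compact_svd M U \<Sigma> V \<longleftrightarrow>
     (let r = mat_rank M in
        U \<in> carrier_mat (dim_row M) r \<and> \<Sigma> \<in> carrier_mat r r \<and> V \<in> carrier_mat (dim_col M) r \<and>
        transpose_mat U * U = 1\<^sub>m r \<and> transpose_mat V * V = 1\<^sub>m r \<and>
        diagonal_mat \<Sigma> \<and>
        (\<forall>i<r. 0 < \<Sigma> $$ (i, i)) \<and>
        (\<forall>i<r. \<forall>j<r. i \<le> j \<longrightarrow> \<Sigma> $$ (j, j) \<le> \<Sigma> $$ (i, i)) \<and>
        M = U * \<Sigma> * transpose_mat V)"

definition first_cols :: "nat \<Rightarrow> real mat \<Rightarrow> real mat" where
  "first_cols r X = mat_of_cols (dim_row X) (take r (cols X))"

text \<open>Head and tail of \<open>M\<close> at \<open>r\<close>, where \<open>U\<close> is the matrix of left singular vectors in a chosen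
  decomposition of \<open>M\<close>.  The lemma \<open>svd_head_right\<close> below gives the equal expression in terms of
  the right singular vectors.\<close>

definition svd_head :: "nat \<Rightarrow> real mat \<Rightarrow> real mat \<Rightarrow> real mat" where
  "svd_head r U M = first_cols r U * transpose_mat (first_cols r U) * M"

definition svd_tail :: "nat \<Rightarrow> real mat \<Rightarrow> real mat \<Rightarrow> real mat" where
  "svd_tail r U M = M - svd_head r U M"

lemma first_cols_mult:
  assumes "X \<in> carrier_mat n q" "r \<le> q"
  shows "first_cols r X = X * mat q r (\<lambda>(i, j). if i = j then 1 else 0)"
proof (rule eq_matI)
  fix i j
  assume "i < dim_row (X * mat q r (\<lambda>(i, j). if i = j then 1 else (0::real)))"
    and "j < dim_col (X * mat q r (\<lambda>(i, j). if i = j then 1 else (0::real)))"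
  with assms have ij: "i < n" "j < r" by auto
  have "(X * mat q r (\<lambda>(i, j). if i = j then 1 else 0)) $$ (i, j)
      = (\<Sum>l = 0..<q. X $$ (i, l) * (if l = j then 1 else 0))"
    using assms ij by (auto simp: scalar_prod_def intro!: sum.cong)
  also have "\<dots> = X $$ (i, j)"
    using assms ij by (simp add: if_distrib cong: if_cong)
  finally show "first_cols r X $$ (i, j)
      = (X * mat q r (\<lambda>(i, j). if i = j then 1 else 0)) $$ (i, j)"
    using assms ij by (simp add: first_cols_def mat_of_cols_def)
qed (use assms in \<open>auto simp: first_cols_def\<close>)

lemma svd_head_right:
  assumes svd: "compact_svd M U \<Sigma> V" and r: "r \<le> mat_rank M"
  shows "svd_head r U M = M * first_cols r V * transpose_mat (first_cols r V)"
proof -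
  define q where "q = mat_rank M"
  define n where "n = dim_row M"
  define d where "d = dim_col M"
  define E :: "real mat" where "E = mat q r (\<lambda>(i, j). if i = j then 1 else 0)"
  define D where "D = E * transpose_mat E"
  have U: "U \<in> carrier_mat n q" and S: "\<Sigma> \<in> carrier_mat q q" and V: "V \<in> carrier_mat d q"
    and UU: "transpose_mat U * U = 1\<^sub>m q" and VV: "transpose_mat V * V = 1\<^sub>m q"
    and diag: "diagonal_mat \<Sigma>" and M: "M = U * \<Sigma> * transpose_mat V"
    using svd unfolding compact_svd_def Let_def q_def n_def d_def by blast+
  have E: "E \<in> carrier_mat q r" unfolding E_def by simp
  have D: "D \<in> carrier_mat q q" using E unfolding D_def by simp
  have rq: "r \<le> q" using r unfolding q_def .
  have fU: "first_cols r U = U * E" and fV: "first_cols r V = V * E"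
    using first_cols_mult[OF U rq] first_cols_mult[OF V rq] unfolding E_def by auto
  have D_index: "D $$ (i, j) = (if i = j \<and> i < r then 1 else 0)" if "i < q" "j < q" for i j
  proof -
    have "D $$ (i, j) = (\<Sum>l = 0..<r. (if i = l then 1 else 0) * (if j = l then 1 else 0))"
      using that unfolding D_def E_def by (auto simp: scalar_prod_def intro!: sum.cong)
    also have "\<dots> = (\<Sum>l = 0..<r. if l = i then (if i = j then 1 else 0) else 0)"
      by (intro sum.cong) auto
    finally show ?thesis by auto
  qed
  have comm: "D * \<Sigma> = \<Sigma> * D"
  proof (rule eq_matI)
    fix i j
    assume "i < dim_row (\<Sigma> * D)" "j < dim_col (\<Sigma> * D)"
    then have ij: "i < q" "j < q" using S D by auto
    have diag0: "\<Sigma> $$ (a, b) = 0" if "a < q" "b < q" "a \<noteq> b" for a b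
      using diag S that unfolding diagonal_mat_def by auto
    have "(D * \<Sigma>) $$ (i, j) = (\<Sum>l = 0..<q. D $$ (i, l) * \<Sigma> $$ (l, j))"
      using S D ij by (auto simp: scalar_prod_def intro!: sum.cong)
    also have "\<dots> = (\<Sum>l = 0..<q. \<Sigma> $$ (i, l) * D $$ (l, j))"
      using ij diag0 by (cases "i = j") (auto simp: D_index intro!: sum.cong)
    also have "\<dots> = (\<Sigma> * D) $$ (i, j)"
      using S D ij by (auto simp: scalar_prod_def intro!: sum.cong)
    finally show "(D * \<Sigma>) $$ (i, j) = (\<Sigma> * D) $$ (i, j)" .
  qed (use S D in auto)
  have dims: "dim_row U = n" "dim_col U = q" "dim_row V = d" "dim_col V = q" "dim_row E = q"
    "dim_col E = r" "dim_row \<Sigma> = q" "dim_col \<Sigma> = q" "dim_row D = q" "dim_col D = q"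
    using U V E S D by auto
  have assoc: "X * Y * Z = X * (Y * Z)"
    if "dim_col X = dim_row Y" "dim_col Y = dim_row Z" for X Y Z :: "real mat"
    using that by (metis assoc_mult_mat carrier_matI)
  have "svd_head r U M = U * D * (transpose_mat U * U) * \<Sigma> * transpose_mat V"
    unfolding svd_head_def fU M D_def transpose_mult[OF U E] by (simp add: assoc dims)
  also have "\<dots> = U * (D * \<Sigma>) * transpose_mat V"
    using U D S unfolding UU by (simp add: assoc dims)
  also have "\<dots> = U * \<Sigma> * (transpose_mat V * V) * D * transpose_mat V"
    using U D S unfolding UU VV comm by (simp add: assoc dims)
  also have "\<dots> = M * (V * E) * transpose_mat (V * E)"
    unfolding M D_def transpose_mult[OF V E] by (simp add: assoc dims)
  finally show ?thesis unfolding fV .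
qed

end

(* Let Y = I - P, let W be the first k columns of V, and let H = A W W^T and T = A - H be the head
   and the tail.  Expanding |Y A S|^2 along A S = H S + T S and comparing with |Y A|^2 gives three
   errors, each at most eps/3 |Y A|^2.
   Head: the subspace embedding applied to the rows of Y H.
   Cross term: since T W = 0, it equals 2 <Y A W, T S S^T W>, to which Cauchy-Schwarz and the
   second approximate multiplication apply.
   Tail: by Pythagoras it is the Frobenius preservation error minus <P, T S S^T T^T - T T^T>, and
   |P|^2 = rank P <= k absorbs the factor 1 / sqrt k.
   The errors measured in |T|^2 are paid for by Eckart-Young: |T|^2 <= |Y A|^2. *)

theory Submission
  imports Defs "HOL-Analysis.L2_Norm"
begin

section \<open>The trace inner product behind the Frobenius norm\<close>

text \<open>This is tr(X^T Y). Working with it instead of the norm gives access to cross terms and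
  adjoints. The index ranges come from \<open>X\<close> alone, so even symmetry needs both matrices
  in one carrier.\<close>

definition mat_inner :: "real mat \<Rightarrow> real mat \<Rightarrow> real" where
  "mat_inner X Y = (\<Sum>i<dim_row X. \<Sum>j<dim_col X. X $$ (i, j) * Y $$ (i, j))"

lemma frob_norm_square: "(frob_norm X)\<^sup>2 = mat_inner X X"
  unfolding frob_norm_def mat_inner_def
  by (subst real_sqrt_pow2) (auto simp: power2_eq_square intro!: sum_nonneg)

lemma frob_norm_nonneg: "0 \<le> frob_norm X"
  unfolding frob_norm_def by (auto intro!: sum_nonneg)

lemma mat_inner_self_nonneg: "0 \<le> mat_inner X X"
  using frob_norm_square[of X] by (metis zero_le_power2)

lemma mat_inner_commute:
  assumes "X \<in> carrier_mat p q" "Y \<in> carrier_mat p q"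
  shows "mat_inner X Y = mat_inner Y X"
  using assms unfolding mat_inner_def by (auto simp: mult.commute)

lemma mat_inner_diff_right:
  assumes "X \<in> carrier_mat p q" "Y \<in> carrier_mat p q" "Z \<in> carrier_mat p q"
  shows "mat_inner X (Y - Z) = mat_inner X Y - mat_inner X Z"
  using assms unfolding mat_inner_def by (auto simp: algebra_simps sum_subtractf)

lemma mat_inner_add_self:
  assumes "X \<in> carrier_mat p q" "Y \<in> carrier_mat p q"
  shows "mat_inner (X + Y) (X + Y) = mat_inner X X + 2 * mat_inner X Y + mat_inner Y Y"
  using assms unfolding mat_inner_def
  by (auto simp: algebra_simps sum.distrib sum_distrib_left)

lemma mat_inner_diff_self:
  assumes "X \<in> carrier_mat p q" "Y \<in> carrier_mat p q"
  shows "mat_inner (X - Y) (X - Y) = mat_inner X X - 2 * mat_inner X Y + mat_inner Y Y"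
  using assms unfolding mat_inner_def
  by (auto simp: algebra_simps sum.distrib sum_subtractf sum_distrib_left)

lemma mat_inner_transpose:
  assumes "X \<in> carrier_mat p q" "Y \<in> carrier_mat p q"
  shows "mat_inner (transpose_mat X) (transpose_mat Y) = mat_inner X Y"
  using assms unfolding mat_inner_def by (auto intro: sum.swap)

text \<open>Adjointness plays the role of cyclicity of the trace: later proofs move factors across
  the inner product with this lemma and its left-hand twin. It holds row by row, by exchanging two
  finite sums.\<close>

lemma mat_inner_mult_right:
  assumes M: "M \<in> carrier_mat p n" and X: "X \<in> carrier_mat n q" and N: "N \<in> carrier_mat p q"
  shows "mat_inner (M * X) N = mat_inner M (N * transpose_mat X)"
proof -
  have "(\<Sum>j<q. (M * X) $$ (i, j) * N $$ (i, j)) =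
      (\<Sum>l<n. M $$ (i, l) * (N * transpose_mat X) $$ (i, l))" if i: "i < p" for i
  proof -
    have "(\<Sum>j<q. (M * X) $$ (i, j) * N $$ (i, j)) =
        (\<Sum>j<q. \<Sum>l<n. M $$ (i, l) * (N $$ (i, j) * X $$ (l, j)))"
      using assms i
      by (auto simp: scalar_prod_def sum_distrib_left sum_distrib_right algebra_simps
          lessThan_atLeast0 intro!: sum.cong)
    also have "\<dots> = (\<Sum>l<n. \<Sum>j<q. M $$ (i, l) * (N $$ (i, j) * X $$ (l, j)))"
      by (rule sum.swap)
    also have "\<dots> = (\<Sum>l<n. M $$ (i, l) * (N * transpose_mat X) $$ (i, l))"
      using assms i
      by (auto simp: scalar_prod_def sum_distrib_left lessThan_atLeast0 intro!: sum.cong)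
    finally show ?thesis .
  qed
  then show ?thesis using assms unfolding mat_inner_def by auto
qed

text \<open>Transposing both arguments turns left multiplication into right multiplication.\<close>

lemma mat_inner_mult_left:
  assumes X: "X \<in> carrier_mat p n" and M: "M \<in> carrier_mat n q" and N: "N \<in> carrier_mat p q"
  shows "mat_inner (X * M) N = mat_inner M (transpose_mat X * N)"
proof -
  have "mat_inner (X * M) N = mat_inner (transpose_mat M * transpose_mat X) (transpose_mat N)"
    using mat_inner_transpose[of "X * M" p q N] transpose_mult[OF X M] assms by simp
  also have "\<dots> = mat_inner (transpose_mat M) (transpose_mat N * transpose_mat (transpose_mat X))"
    by (rule mat_inner_mult_right) (use assms in auto)
  also have "\<dots> = mat_inner (transpose_mat M) (transpose_mat (transpose_mat X * N))"
    using transpose_mult[of "transpose_mat X" n p N q] assms by simp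
  also have "\<dots> = mat_inner M (transpose_mat X * N)"
    by (rule mat_inner_transpose) (use assms in auto)
  finally show ?thesis .
qed

text \<open>A matrix read as a function on index pairs reduces this to the inequality for finite
  sums.\<close>

lemma mat_inner_Cauchy_Schwarz:
  assumes X: "X \<in> carrier_mat p q" and Y: "Y \<in> carrier_mat p q"
  shows "\<bar>mat_inner X Y\<bar> \<le> frob_norm X * frob_norm Y"
proof -
  let ?I = "{..<p} \<times> {..<q}"
  have frob: "frob_norm Z = L2_set (\<lambda>z. Z $$ z) ?I" if "Z \<in> carrier_mat p q" for Z
    using that unfolding frob_norm_def L2_set_def by (simp add: sum.cartesian_product)
  have "mat_inner X Y = (\<Sum>z\<in>?I. X $$ z * Y $$ z)"
    using X Y unfolding mat_inner_def by (simp add: sum.cartesian_product case_prod_unfold)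
  also have "\<bar>\<dots>\<bar> \<le> (\<Sum>z\<in>?I. \<bar>X $$ z\<bar> * \<bar>Y $$ z\<bar>)"
    by (rule sum_abs[THEN order_trans]) (simp add: abs_mult)
  also have "\<dots> \<le> frob_norm X * frob_norm Y"
    unfolding frob[OF X] frob[OF Y] by (rule L2_set_mult_ineq)
  finally show ?thesis .
qed

lemma mat_inner_one: "mat_inner (1\<^sub>m r) (1\<^sub>m r) = real r"
  unfolding mat_inner_def by (simp add: if_distrib cong: if_cong)

section \<open>Rank, trace and Pythagorean identities for projections\<close>

lemma assoc_mult_mat_dim:
  fixes X Y Z :: "'a :: semiring_0 mat"
  assumes "dim_col X = dim_row Y" "dim_col Y = dim_row Z"
  shows "X * Y * Z = X * (Y * Z)"
  using assms by (metis assoc_mult_mat carrier_matI)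

text \<open>The columns of \<open>B\<close> are a basis of the column space chosen among the columns
  of \<open>P\<close>, and \<open>C\<close> holds the coordinates of all columns in that basis. An
  idempotent fixes its own columns, so \<open>B * (C * B) = B\<close>, and the injective
  \<open>B\<close> cancels. This connects rank, a count of independent columns, with the
  trace.\<close>

lemma (in vec_space) rank_idempotent_factorization:
  assumes P: "P \<in> carrier_mat n n" and idem: "P * P = P"
  obtains B C where "B \<in> carrier_mat n (rank P)" "C \<in> carrier_mat (rank P) n"
    "P = B * C" "C * B = 1\<^sub>m (rank P)"
proof -
  have cols: "set (cols P) \<subseteq> carrier_vec n" using cols_dim[of P] P by auto
  obtain W where max: "maximal W (\<lambda>T. T \<subseteq> set (cols P) \<and> lin_indpt T)"
    using maximal_exists_superset[of "set (cols P)" "\<lambda>T. T \<subseteq> set (cols P) \<and> lin_indpt T" "{}"]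
    by (auto simp: finite_lin_indpt2)
  then have W: "W \<subseteq> set (cols P)" "lin_indpt W" by (auto simp: maximal_def)
  then obtain ws where ws: "set ws = W" "distinct ws"
    using finite_distinct_list[of W] finite_subset by blast
  define r where "r = length ws"
  have r: "rank P = r"
    using rank_card_indpt[OF P max] ws distinct_card unfolding r_def by fastforce
  define B where "B = mat_of_cols n ws"
  have B: "B \<in> carrier_mat n r" unfolding B_def r_def by simp
  have wsn: "set ws \<subseteq> carrier_vec n" using ws W cols by auto
  have colsB: "cols B = ws" unfolding B_def by (simp add: wsn)
  have inj: "v = 0\<^sub>v r" if "v \<in> carrier_vec r" "B *\<^sub>v v = 0\<^sub>v n" for v
    using lin_depI[OF B that(1) _ that(2)] ws W colsB by auto
  \<comment> \<open>A column outside the span could be adjoined to \<open>W\<close>, against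
    maximality.\<close>
  have span: "c \<in> span W" if c: "c \<in> set (cols P)" for c
  proof (rule ccontr)
    assume nc: "c \<notin> span W"
    have WV: "W \<subseteq> carrier_vec n" using W cols by auto
    have cV: "c \<in> carrier_vec n" using c cols by auto
    have cW: "c \<notin> W" using nc WV span_mem by auto
    have "lin_indpt (W \<union> {c})"
      using lin_dep_iff_in_span[OF WV W(2) cV cW] nc by auto
    then have "W \<union> {c} = W" using max c W unfolding maximal_def by blast
    then show False using cW by auto
  qed
  have "\<exists>x\<in>carrier_vec r. B *\<^sub>v x = col P j" if j: "j < n" for j
  proof -
    have "col P j \<in> span W"
      using j P by (intro span) (metis carrier_matD(2) cols_length cols_nth nth_mem)
    then have "col P j \<in> col_space B" unfolding col_space_def colsB ws .
    then show ?thesis using col_space_eq[OF B] B by auto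
  qed
  then obtain x where x: "\<And>j. j < n \<Longrightarrow> x j \<in> carrier_vec r \<and> B *\<^sub>v x j = col P j"
    by metis
  define C where "C = mat_of_cols r (map x [0..<n])"
  have C: "C \<in> carrier_mat r n" unfolding C_def by (intro carrier_matI) auto
  have PBC: "P = B * C"
  proof (rule mat_col_eqI)
    fix j assume "j < dim_col (B * C)"
    then have j: "j < n" using C by simp
    have "col C j = x j" unfolding C_def using j x by (subst col_mat_of_cols) auto
    then show "col P j = col (B * C) j" using j x col_mult2[OF B C j] by simp
  qed (use P B C in auto)
  have "C * B = 1\<^sub>m r"
  proof (rule mat_col_eqI)
    fix i assume "i < dim_col (1\<^sub>m r)"
    then have i: "i < r" by simp
    have "col B i \<in> set (cols P)" using i W ws colsB
      unfolding B_def r_def using nth_mem[of i ws] by (metis col_mat_of_cols subsetD wsn)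
    then obtain j where j: "j < n" "col B i = col P j"
      using P by (metis carrier_matD(2) cols_length cols_nth in_set_conv_nth)
    have CB: "C * B \<in> carrier_mat r r" using B C by simp
    have "B *\<^sub>v (col (C * B) i) = col (B * (C * B)) i"
      using col_mult2[OF B CB i] by simp
    also have "\<dots> = col (P * B) i" using PBC B C by simp
    also have "\<dots> = P *\<^sub>v col P j" using col_mult2[OF P B i] j by simp
    also have "\<dots> = col (P * P) j" using col_mult2[OF P P] j by simp
    also have "\<dots> = col B i" using idem j by simp
    also have "\<dots> = col (B * 1\<^sub>m r) i" using B by simp
    also have "\<dots> = B *\<^sub>v unit_vec r i" using B i by (subst col_mult2[OF B]) auto
    finally have eq: "B *\<^sub>v (col (C * B) i) = B *\<^sub>v unit_vec r i" .
    \<comment> \<open>\<open>B\<close> is cancelled by applying \<open>inj\<close> to the difference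
      of the two arguments.\<close>
    have "col (C * B) i - unit_vec r i = 0\<^sub>v r"
      using eq B C i by (intro inj) (auto simp: mult_minus_distrib_mat_vec[OF B])
    then have d: "\<forall>l<r. col (C * B) i $ l - unit_vec r i $ l = 0"
      by (metis index_minus_vec(1) index_unit_vec(3) index_zero_vec(1))
    show "col (C * B) i = col (1\<^sub>m r) i"
      using d C i by (intro eq_vecI) auto
  qed (use B C in auto)
  then show thesis using that B C PBC unfolding r by blast
qed

text \<open>Pairing with the identity is the trace, so the chain reads |P|^2 = tr(P P) = tr(B C) =
  tr(C B), the trace of an identity matrix whose size is the rank.\<close>

lemma orthogonal_projection_mat_inner_self:
  assumes P: "orthogonal_projection_mat n P"
  shows "mat_inner P P = real (vec_space.rank n P)"
proof -
  interpret vec_space "TYPE(real)" n .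
  have Pc: "P \<in> carrier_mat n n" and idem: "P * P = P" and sym: "transpose_mat P = P"
    using P unfolding orthogonal_projection_mat_def by auto
  obtain B C where B: "B \<in> carrier_mat n (rank P)" and C: "C \<in> carrier_mat (rank P) n"
    and BC: "P = B * C" and CB: "C * B = 1\<^sub>m (rank P)"
    using rank_idempotent_factorization[OF Pc idem] by blast
  have "mat_inner P P = mat_inner (P * P) (1\<^sub>m n)"
    using mat_inner_mult_left[OF Pc Pc, of "1\<^sub>m n"] Pc sym by simp
  also have "\<dots> = mat_inner (B * C) (1\<^sub>m n)" using idem BC by simp
  also have "\<dots> = mat_inner C (transpose_mat B)"
    using mat_inner_mult_left[OF B C, of "1\<^sub>m n"] B by simp
  also have "\<dots> = mat_inner (C * B) (1\<^sub>m (rank P))"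
    using mat_inner_mult_right[OF C B, of "1\<^sub>m (rank P)"] B by simp
  finally show ?thesis unfolding CB mat_inner_one .
qed

text \<open>Symmetry and idempotence give <M, P M> = |P M|^2, so \<open>P * M\<close> is orthogonal
  to \<open>M - P * M\<close>.\<close>

lemma orthogonal_projection_pythagoras:
  assumes P: "orthogonal_projection_mat n P" and M: "M \<in> carrier_mat n q"
  shows "mat_inner (M - P * M) (M - P * M) = mat_inner M M - mat_inner (P * M) (P * M)"
proof -
  have Pc: "P \<in> carrier_mat n n" and idem: "P * P = P" and sym: "transpose_mat P = P"
    using P unfolding orthogonal_projection_mat_def by auto
  have "mat_inner (P * M) (P * M) = mat_inner M (P * M)"
    using mat_inner_mult_left[OF Pc M, of "P * M"] Pc M sym idem
    by (simp flip: assoc_mult_mat[OF Pc Pc M])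
  then show ?thesis using mat_inner_diff_self[of M n q "P * M"] Pc M by simp
qed

lemma mat_inner_mult_orthonormal_cols:
  assumes X: "X \<in> carrier_mat p r" and V: "V \<in> carrier_mat q r"
    and VV: "transpose_mat V * V = 1\<^sub>m r"
  shows "mat_inner (X * transpose_mat V) (X * transpose_mat V) = mat_inner X X"
  using mat_inner_mult_right[of X p r "transpose_mat V" q "X * transpose_mat V"] X V VV
  by (simp add: assoc_mult_mat_dim)

lemma mat_inner_orthonormal_mult:
  assumes X: "X \<in> carrier_mat r p" and U: "U \<in> carrier_mat q r"
    and UU: "transpose_mat U * U = 1\<^sub>m r"
  shows "mat_inner (U * X) (U * X) = mat_inner X X"
  using mat_inner_mult_left[OF U X, of "U * X"] X U UU
  by (simp flip: assoc_mult_mat_dim)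

text \<open>Each row of \<open>X\<close> splits into its component in the column space of
  \<open>V\<close> and an orthogonal remainder. This yields both Bessel's inequality and the energy
  of the tail.\<close>

lemma orthonormal_cols_pythagoras:
  assumes X: "X \<in> carrier_mat p q" and V: "V \<in> carrier_mat q r"
    and VV: "transpose_mat V * V = 1\<^sub>m r"
  shows "mat_inner (X - X * V * transpose_mat V) (X - X * V * transpose_mat V)
    = mat_inner X X - mat_inner (X * V) (X * V)"
proof -
  have "mat_inner X (X * V * transpose_mat V) = mat_inner (X * V) (X * V)"
    using mat_inner_mult_right[OF X V, of "X * V"] X V by simp
  moreover have "mat_inner (X * V * transpose_mat V) (X * V * transpose_mat V)
      = mat_inner (X * V) (X * V)"
    by (rule mat_inner_mult_orthonormal_cols[OF _ V VV]) (use X V in auto)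
  ultimately show ?thesis
    using mat_inner_diff_self[of X p q "X * V * transpose_mat V"] X V by simp
qed

text \<open>The squared Frobenius norm is a sum over rows, and every row of \<open>X * M\<close> is
  x^T M for a row x of \<open>X\<close>; the vector guarantee is summed over these rows.\<close>

lemma subspace_embedding_mat_inner:
  assumes emb: "subspace_embedding e M S" and M: "M \<in> carrier_mat n d" and S: "S \<in> carrier_mat d m"
    and X: "X \<in> carrier_mat p n"
  shows "\<bar>mat_inner (X * M) (X * M) - mat_inner (X * M * S) (X * M * S)\<bar>
    \<le> e * mat_inner (X * M) (X * M)"
proof -
  have norm_row: "(l2_norm (transpose_mat N *\<^sub>v row X i))\<^sup>2
      = (\<Sum>j<q. (X * N) $$ (i, j) * (X * N) $$ (i, j))"
    if N: "N \<in> carrier_mat n q" and i: "i < p" for N q i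
  proof -
    have "(l2_norm (transpose_mat N *\<^sub>v row X i))\<^sup>2
        = (transpose_mat N *\<^sub>v row X i) \<bullet> (transpose_mat N *\<^sub>v row X i)"
      unfolding l2_norm_def by (rule real_sqrt_pow2) (simp add: scalar_prod_def sum_nonneg)
    also have "\<dots> = (\<Sum>j<q. (X * N) $$ (i, j) * (X * N) $$ (i, j))"
      using N X i unfolding scalar_prod_def
      by (auto simp: lessThan_atLeast0 scalar_prod_def mult.commute intro!: sum.cong)
    finally show ?thesis .
  qed
  let ?a = "\<lambda>i. (l2_norm (transpose_mat M *\<^sub>v row X i))\<^sup>2"
  let ?b = "\<lambda>i. (l2_norm (transpose_mat (M * S) *\<^sub>v row X i))\<^sup>2"
  have a: "mat_inner (X * M) (X * M) = (\<Sum>i<p. ?a i)"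
    using X M unfolding mat_inner_def by (simp add: norm_row[OF M])
  have "mat_inner (X * (M * S)) (X * (M * S)) = (\<Sum>i<p. ?b i)"
    using X M S unfolding mat_inner_def by (simp add: norm_row[of "M * S" m])
  then have b: "mat_inner (X * M * S) (X * M * S) = (\<Sum>i<p. ?b i)"
    using X M S by simp
  have "\<bar>(\<Sum>i<p. ?a i) - (\<Sum>i<p. ?b i)\<bar> \<le> (\<Sum>i<p. \<bar>?a i - ?b i\<bar>)"
    unfolding sum_subtractf[symmetric] by (rule sum_abs)
  also have "\<dots> \<le> (\<Sum>i<p. e * ?a i)"
    using emb X M unfolding subspace_embedding_def by (intro sum_mono) auto
  finally show ?thesis unfolding a b sum_distrib_left .
qed


section \<open>Eckart-Young: the energy captured by a projection of rank at most k\<close>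

text \<open>The value \<open>s k\<close> serves as a threshold. Before index \<open>k\<close> the
  factor \<open>w i - 1\<close> is nonpositive and \<open>s i\<close> is at least
  \<open>s k\<close>; from \<open>k\<close> on, \<open>s i\<close> is at most \<open>s k\<close>.
  Replacing every \<open>s i\<close> by \<open>s k\<close> therefore only increases the difference,
  which becomes \<open>s k\<close> times a nonpositive number.\<close>

lemma weighted_sum_le_sum_largest:
  fixes s w :: "nat \<Rightarrow> real"
  assumes kq: "k \<le> q" and nonneg: "\<And>i. i < q \<Longrightarrow> 0 \<le> s i"
    and dec: "\<And>i j. i \<le> j \<Longrightarrow> j < q \<Longrightarrow> s j \<le> s i"
    and w0: "\<And>i. i < q \<Longrightarrow> 0 \<le> w i" and w1: "\<And>i. i < q \<Longrightarrow> w i \<le> 1"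
    and sum: "(\<Sum>i<q. w i) \<le> real k"
  shows "(\<Sum>i<q. s i * w i) \<le> (\<Sum>i<k. s i)"
proof (cases "k = q")
  \<comment> \<open>Here index \<open>k\<close> is out of range and gives no threshold, but
    \<open>w i \<le> 1\<close> suffices.\<close>
  case True
  show ?thesis unfolding True
    by (rule sum_mono) (simp add: mult_left_le nonneg w1)
next
  case False
  then have k: "k < q" using kq by simp
  have split: "(\<Sum>i<q. f i) = (\<Sum>i<k. f i) + (\<Sum>i\<in>{k..<q}. f i)" for f :: "nat \<Rightarrow> real"
    using kq by (simp add: lessThan_atLeast0 sum.atLeastLessThan_concat)
  have head: "(\<Sum>i<k. s i * (w i - 1)) \<le> (\<Sum>i<k. s k * (w i - 1))"
    using k by (intro sum_mono mult_right_mono_neg) (auto simp: dec w1)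
  have tail: "(\<Sum>i\<in>{k..<q}. s i * w i) \<le> (\<Sum>i\<in>{k..<q}. s k * w i)"
    by (intro sum_mono mult_right_mono) (auto simp: dec w0)
  have "(\<Sum>i<q. s i * w i) - (\<Sum>i<k. s i)
      = (\<Sum>i<k. s i * (w i - 1)) + (\<Sum>i\<in>{k..<q}. s i * w i)"
    unfolding split by (simp add: algebra_simps sum_subtractf)
  also have "\<dots> \<le> (\<Sum>i<k. s k * (w i - 1)) + (\<Sum>i\<in>{k..<q}. s k * w i)"
    using head tail by simp
  also have "\<dots> = s k * ((\<Sum>i<q. w i) - real k)"
    unfolding split by (simp add: algebra_simps sum_subtractf sum_distrib_left)
  also have "\<dots> \<le> 0" using sum nonneg[OF k] by (simp add: mult_nonneg_nonpos)
  finally show ?thesis by simp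
qed

lemma mat_inner_mult_diagonal:
  assumes X: "X \<in> carrier_mat p q" and D: "D \<in> carrier_mat q q" and diag: "diagonal_mat D"
  shows "mat_inner (X * D) (X * D)
    = (\<Sum>j<q. (D $$ (j, j))\<^sup>2 * (\<Sum>i<p. (X $$ (i, j))\<^sup>2))"
proof -
  have "(X * D) $$ (i, j) = X $$ (i, j) * D $$ (j, j)" if "i < p" "j < q" for i j
  proof -
    have "(X * D) $$ (i, j) = (\<Sum>l = 0..<q. X $$ (i, l) * D $$ (l, j))"
      using X D that by (auto simp: scalar_prod_def intro!: sum.cong)
    also have "\<dots> = (\<Sum>l = 0..<q. if l = j then X $$ (i, j) * D $$ (j, j) else 0)"
      using diag D that unfolding diagonal_mat_def by (intro sum.cong) auto
    finally show ?thesis using that by simp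
  qed
  then have "mat_inner (X * D) (X * D)
      = (\<Sum>i<p. \<Sum>j<q. (D $$ (j, j))\<^sup>2 * (X $$ (i, j))\<^sup>2)"
    using X D unfolding mat_inner_def by (simp add: power2_eq_square algebra_simps)
  also have "\<dots> = (\<Sum>j<q. (D $$ (j, j))\<^sup>2 * (\<Sum>i<p. (X $$ (i, j))\<^sup>2))"
    by (subst sum.swap) (simp add: sum_distrib_left)
  finally show ?thesis .
qed

lemma gram_diagonal:
  fixes X :: "real mat"
  assumes "X \<in> carrier_mat p q" "j < q"
  shows "(transpose_mat X * X) $$ (j, j) = (\<Sum>i<p. (X $$ (i, j))\<^sup>2)"
  using assms by (auto simp: scalar_prod_def power2_eq_square lessThan_atLeast0 intro!: sum.cong)

text \<open>The squared cosines \<open>\<parallel>P u\<^sub>j\<parallel>\<^sup>2\<close> lie in \<open>[0, 1]\<close> and by Bessel sum to at most the rank of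
  \<open>P\<close>, so the captured energy \<open>\<Sum> \<sigma>\<^sub>j\<^sup>2 \<parallel>P u\<^sub>j\<parallel>\<^sup>2\<close> is largest when
  the weight sits on the first \<open>k\<close> indices.\<close>

lemma svd_projection_energy_le:
  assumes A: "A \<in> carrier_mat n d" and svd: "compact_svd A U \<Sigma> V" and k: "k \<le> mat_rank A"
    and P: "orthogonal_projection_mat n P" and rank: "vec_space.rank n P \<le> k"
  shows "mat_inner (P * A) (P * A) \<le> (\<Sum>i<k. (\<Sigma> $$ (i, i))\<^sup>2)"
proof -
  define q where "q = mat_rank A"
  have U: "U \<in> carrier_mat n q" and D: "\<Sigma> \<in> carrier_mat q q" and V: "V \<in> carrier_mat d q"
    and UU: "transpose_mat U * U = 1\<^sub>m q" and VV: "transpose_mat V * V = 1\<^sub>m q"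
    and diag: "diagonal_mat \<Sigma>" and pos: "\<forall>i<q. 0 < \<Sigma> $$ (i, i)"
    and dec: "\<forall>i<q. \<forall>j<q. i \<le> j \<longrightarrow> \<Sigma> $$ (j, j) \<le> \<Sigma> $$ (i, i)"
    and AU: "A = U * \<Sigma> * transpose_mat V"
    using svd A unfolding compact_svd_def Let_def q_def by auto
  have Pc: "P \<in> carrier_mat n n" and idem: "P * P = P" and sym: "transpose_mat P = P"
    using P unfolding orthogonal_projection_mat_def by auto
  define w where "w j = (\<Sum>i<n. ((P * U) $$ (i, j))\<^sup>2)" for j
  have PU: "P * U \<in> carrier_mat n q" using Pc U by simp
  \<comment> \<open>Expand 0 \<le> |u_j - P u_j|^2 for the unit vector u_j: the inner product <u_j,
    P u_j> is again \<open>w j\<close>, because \<open>P\<close> is a symmetric idempotent.\<close>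
  have w1: "w j \<le> 1" if j: "j < q" for j
  proof -
    have YU: "U - P * U \<in> carrier_mat n q" by (rule minus_carrier_mat[OF PU])
    have PtU: "transpose_mat (P * U) = transpose_mat U * P"
      using transpose_mult[OF Pc U] sym by simp
    have PPU: "P * (P * U) = P * U"
      using assoc_mult_mat[OF Pc Pc U] idem by simp
    have gram: "transpose_mat (P * U) * (P * U) = transpose_mat U * (P * U)"
      unfolding PtU using U Pc PPU by (simp add: assoc_mult_mat_dim)
    have "(\<Sum>i<n. ((U - P * U) $$ (i, j))\<^sup>2)
        = (\<Sum>i<n. (U $$ (i, j))\<^sup>2) - 2 * (\<Sum>i<n. U $$ (i, j) * (P * U) $$ (i, j)) + w j"
      unfolding w_def using j U Pc
      by (simp add: power2_diff sum.distrib sum_subtractf sum_distrib_left mult.assoc)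
    also have "(\<Sum>i<n. (U $$ (i, j))\<^sup>2) = 1"
      using gram_diagonal[OF U j] UU j by simp
    also have "(\<Sum>i<n. U $$ (i, j) * (P * U) $$ (i, j)) = (transpose_mat U * (P * U)) $$ (j, j)"
      using j U Pc by (auto simp: scalar_prod_def[of "col U j"] lessThan_atLeast0 intro!: sum.cong)
    also have "\<dots> = w j"
      unfolding gram[symmetric] gram_diagonal[OF PU j] w_def ..
    finally have "0 \<le> 1 - 2 * w j + w j" by (metis sum_nonneg zero_le_power2)
    then show ?thesis by simp
  qed
  have "(\<Sum>j<q. w j) = mat_inner (P * U) (P * U)"
    unfolding w_def mat_inner_def carrier_matD[OF PU]
    by (subst sum.swap) (simp only: power2_eq_square)
  \<comment> \<open>Bessel, from the nonnegative remainder in the Pythagorean identity for the rows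
    of \<open>P\<close>.\<close>
  also have "\<dots> \<le> mat_inner P P"
    using orthonormal_cols_pythagoras[OF Pc U UU] mat_inner_self_nonneg by (smt (verit))
  also have "\<dots> \<le> real k"
    using orthogonal_projection_mat_inner_self[OF P] rank by simp
  finally have sum_w: "(\<Sum>j<q. w j) \<le> real k" .
  have "P * A = (P * U * \<Sigma>) * transpose_mat V"
    unfolding AU using Pc U D V by (simp add: assoc_mult_mat_dim)
  then have "mat_inner (P * A) (P * A) = mat_inner (P * U * \<Sigma>) (P * U * \<Sigma>)"
    using mat_inner_mult_orthonormal_cols[of "P * U * \<Sigma>" n q V d] Pc U D V VV by simp
  also have "\<dots> = (\<Sum>j<q. (\<Sigma> $$ (j, j))\<^sup>2 * w j)"
    unfolding w_def by (rule mat_inner_mult_diagonal[OF PU D diag])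
  also have "\<dots> \<le> (\<Sum>i<k. (\<Sigma> $$ (i, i))\<^sup>2)"
  proof (rule weighted_sum_le_sum_largest)
    show "(\<Sigma> $$ (j, j))\<^sup>2 \<le> (\<Sigma> $$ (i, i))\<^sup>2" if "i \<le> j" "j < q" for i j
      using pos dec that by (intro power_mono) (auto intro: less_imp_le)
  qed (use k w1 sum_w in \<open>auto simp: q_def w_def sum_nonneg\<close>)
  finally show ?thesis .
qed

lemma first_cols_orthonormal:
  assumes V: "V \<in> carrier_mat d q" and VV: "transpose_mat V * V = 1\<^sub>m q" and k: "k \<le> q"
  shows "first_cols k V \<in> carrier_mat d k"
    and "transpose_mat (first_cols k V) * first_cols k V = 1\<^sub>m k"
proof -
  show fV: "first_cols k V \<in> carrier_mat d k"
    using V k unfolding first_cols_def by (intro carrier_matI) auto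
  have "col (first_cols k V) i = col V i" if "i < k" for i
    using V k that unfolding first_cols_def by (subst col_mat_of_cols) auto
  moreover have "col V i \<bullet> col V j = 1\<^sub>m q $$ (i, j)" if "i < q" "j < q" for i j
    using arg_cong[OF VV, of "\<lambda>Z. Z $$ (i, j)"] V that by simp
  ultimately show "transpose_mat (first_cols k V) * first_cols k V = 1\<^sub>m k"
    using fV k by (intro eq_matI) auto
qed

text \<open>The head attains the bound of \<open>svd_projection_energy_le\<close>:
  \<open>A * first_cols k V\<close> is \<open>U\<close> times the first k columns of
  \<open>\<Sigma>\<close>, and \<open>U\<close> preserves the norm.\<close>

lemma svd_first_cols_energy:
  assumes A: "A \<in> carrier_mat n d" and svd: "compact_svd A U \<Sigma> V" and k: "k \<le> mat_rank A"
  shows "mat_inner (A * first_cols k V) (A * first_cols k V) = (\<Sum>i<k. (\<Sigma> $$ (i, i))\<^sup>2)"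
proof -
  define q where "q = mat_rank A"
  have U: "U \<in> carrier_mat n q" and D: "\<Sigma> \<in> carrier_mat q q" and V: "V \<in> carrier_mat d q"
    and UU: "transpose_mat U * U = 1\<^sub>m q" and VV: "transpose_mat V * V = 1\<^sub>m q"
    and diag: "diagonal_mat \<Sigma>" and AU: "A = U * \<Sigma> * transpose_mat V"
    using svd A unfolding compact_svd_def Let_def q_def by auto
  have kq: "k \<le> q" using k unfolding q_def .
  define E :: "real mat" where "E = mat q k (\<lambda>(i, j). if i = j then 1 else 0)"
  have E: "E \<in> carrier_mat q k" unfolding E_def by simp
  have "A * first_cols k V = U * (\<Sigma> * (transpose_mat V * V * E))"
    unfolding first_cols_mult[OF V kq] AU E_def[symmetric] using U D V E
    by (simp add: assoc_mult_mat_dim)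
  also have "\<dots> = U * (\<Sigma> * E)" unfolding VV using E by simp
  finally have "mat_inner (A * first_cols k V) (A * first_cols k V) = mat_inner (\<Sigma> * E) (\<Sigma> * E)"
    using mat_inner_orthonormal_mult[of "\<Sigma> * E" q k U n] U UU D E by simp
  also have "\<dots> = (\<Sum>i<q. \<Sum>j<k. if i = j then (\<Sigma> $$ (i, i))\<^sup>2 else 0)"
  proof -
    have "(\<Sigma> * E) $$ (i, j) = (if i = j then \<Sigma> $$ (i, i) else 0)" if "i < q" "j < k" for i j
    proof -
      have "(\<Sigma> * E) $$ (i, j) = (\<Sum>l = 0..<q. \<Sigma> $$ (i, l) * (if l = j then 1 else 0))"
        using D that unfolding E_def by (auto simp: scalar_prod_def intro!: sum.cong)
      also have "\<dots> = \<Sigma> $$ (i, j)"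
        using that kq by (simp add: if_distrib cong: if_cong)
      finally show ?thesis using diag D that kq unfolding diagonal_mat_def by auto
    qed
    moreover have "dim_row (\<Sigma> * E) = q" "dim_col (\<Sigma> * E) = k" using D E by auto
    ultimately show ?thesis
      unfolding mat_inner_def
      by (intro sum.cong) (auto simp: power2_eq_square simp del: index_mult_mat(1))
  qed
  also have "\<dots> = (\<Sum>j<k. (\<Sigma> $$ (j, j))\<^sup>2)"
    using kq by (subst sum.swap) (auto intro!: sum.cong)
  finally show ?thesis .
qed

section \<open>Combining the head, cross and tail errors\<close>

theorem theorem2:
  fixes A S U \<Sigma> V :: "real mat" and n d m k :: nat and \<epsilon> :: real
  assumes A: "A \<in> carrier_mat n d"
    and k: "1 \<le> k" "k \<le> mat_rank A"
    and eps: "0 < \<epsilon>"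
    and svd: "compact_svd A U \<Sigma> V"
    and S: "S \<in> carrier_mat d m"
    and embedding: "subspace_embedding (\<epsilon> / 3) (svd_head k U A) S"
    and tail_tail: "approx_mat_mult (\<epsilon> / (6 * sqrt (real k)))
                      (svd_tail k U A) (transpose_mat (svd_tail k U A)) S"
    and tail_head: "approx_mat_mult (\<epsilon> / (6 * sqrt (real k)))
                      (svd_tail k U A) (first_cols k V) S"
    and norm: "frob_norm_preservation (\<epsilon> / 6) (svd_tail k U A) S"
  shows "projection_cost_preserving_sketch \<epsilon> 0 k A (A * S)"
proof -
  define W where "W = first_cols k V"
  define H where "H = svd_head k U A"
  define T where "T = svd_tail k U A"
  have "V \<in> carrier_mat d (mat_rank A)" "transpose_mat V * V = 1\<^sub>m (mat_rank A)"
    using svd A unfolding compact_svd_def Let_def by auto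
  note W_VV = first_cols_orthonormal[OF this k(2), folded W_def]
  have W: "W \<in> carrier_mat d k" and WW: "transpose_mat W * W = 1\<^sub>m k" by (fact W_VV)+
  \<comment> \<open>In this right-sided form, subtracting the head visibly makes the rows of
    \<open>T\<close> orthogonal to the columns of \<open>W\<close>.\<close>
  have HW: "H = A * W * transpose_mat W"
    unfolding H_def W_def by (rule svd_head_right[OF svd k(2)])
  have TH: "T = A - H" unfolding T_def H_def svd_tail_def ..
  have H: "H \<in> carrier_mat n d" unfolding HW using A W by simp
  have T: "T \<in> carrier_mat n d" unfolding TH by (rule minus_carrier_mat[OF H])
  have AHT: "A = H + T"
    unfolding TH using A H by (intro eq_matI) auto
  have "A * W * transpose_mat W * W = A * W"
    using A W WW by (simp add: assoc_mult_mat_dim)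
  then have TW: "T * W = 0\<^sub>m n k"
    unfolding TH HW using A W by (subst minus_mult_distrib_mat[of _ n d]) auto
  define G where "G = T * S * transpose_mat S * W"
  have G: "G \<in> carrier_mat n k" unfolding G_def using T W by (intro carrier_matI) auto
  have sqrtk: "sqrt (real k) > 0" using k by simp
  have "(frob_norm W)\<^sup>2 = real k"
    unfolding frob_norm_square using mat_inner_orthonormal_mult[of "1\<^sub>m k" k k W d] W WW
    by (simp add: mat_inner_one)
  then have fW: "frob_norm W = sqrt (real k)"
    using frob_norm_nonneg by (metis real_sqrt_abs abs_of_nonneg)
  \<comment> \<open>As \<open>T * W\<close> vanishes, the product error in \<open>tail_head\<close>
    is \<open>0\<^sub>m n k - G\<close>, so that hypothesis bounds \<open>G\<close> itself. The norm
    sqrt k of \<open>W\<close> then cancels the 1 / sqrt k.\<close>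
  have "frob_norm (0\<^sub>m n k - G) = frob_norm G"
    using G unfolding frob_norm_def by simp
  then have "frob_norm G \<le> \<epsilon> / (6 * sqrt (real k)) * frob_norm T * sqrt (real k)"
    using tail_head unfolding approx_mat_mult_def T_def[symmetric] W_def[symmetric] TW
      G_def[symmetric] fW by simp
  then have fG: "frob_norm G \<le> \<epsilon> / 6 * frob_norm T"
    using sqrtk by (simp add: field_simps)
  define K where "K = T * transpose_mat T - T * S * transpose_mat S * transpose_mat T"
  have K: "K \<in> carrier_mat n n" unfolding K_def using T by (intro carrier_matI) auto
  have "frob_norm (transpose_mat T) = frob_norm T"
    using frob_norm_square[of T] frob_norm_square[of "transpose_mat T"] mat_inner_transpose[OF T T]
      frob_norm_nonneg by (metis power2_eq_imp_eq)
  then have fK: "frob_norm K \<le> \<epsilon> / (6 * sqrt (real k)) * (frob_norm T)\<^sup>2"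
    using tail_tail unfolding approx_mat_mult_def T_def[symmetric] K_def[symmetric]
    by (simp add: power2_eq_square mult.assoc)
  have fT: "\<bar>mat_inner T T - mat_inner (T * S) (T * S)\<bar> \<le> \<epsilon> / 6 * mat_inner T T"
    using norm unfolding frob_norm_preservation_def T_def[symmetric] frob_norm_square by simp
  have "(1 - \<epsilon>) * (frob_norm (A - P * A))\<^sup>2 \<le> (frob_norm (A * S - P * (A * S)))\<^sup>2 + 0 \<and>
        (frob_norm (A * S - P * (A * S)))\<^sup>2 + 0 \<le> (1 + \<epsilon>) * (frob_norm (A - P * A))\<^sup>2"
    if P: "orthogonal_projection_mat n P" and rank_P: "mat_rank P \<le> k" for P
  proof -
    have Pc: "P \<in> carrier_mat n n" and idem: "P * P = P" and sym: "transpose_mat P = P"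
      using P unfolding orthogonal_projection_mat_def by auto
    have rank: "vec_space.rank n P \<le> k" using rank_P Pc by simp
    define Y where "Y = 1\<^sub>m n - P"
    have Y: "Y \<in> carrier_mat n n" unfolding Y_def by (rule minus_carrier_mat[OF Pc])
    have YM: "Y * M = M - P * M" if "M \<in> carrier_mat n q" for M q
      unfolding Y_def using minus_mult_distrib_mat[OF _ Pc that, of "1\<^sub>m n"] that by simp
    have Yt: "transpose_mat Y = Y"
      unfolding Y_def using transpose_minus[of "1\<^sub>m n" n n P] Pc sym by simp
    have YY: "Y * Y = Y"
    proof -
      \<comment> \<open>Taking \<open>M = Y\<close> in \<open>YM\<close> then gives
        \<open>Y * Y = Y - P * Y = Y\<close>.\<close>
      have "P * Y = 0\<^sub>m n n"
        unfolding Y_def using mult_minus_distrib_mat[OF Pc _ Pc, of "1\<^sub>m n"] Pc idem by simp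
      then show ?thesis using YM[OF Y] Y by (intro eq_matI) auto
    qed
    have Pyth: "mat_inner (Y * M) (Y * M) = mat_inner M M - mat_inner (P * M) (P * M)"
      if "M \<in> carrier_mat n q" for M q
      unfolding YM[OF that] by (rule orthogonal_projection_pythagoras[OF P that])
    have fP: "frob_norm P \<le> sqrt (real k)"
      using frob_norm_square[of P] orthogonal_projection_mat_inner_self[OF P] rank
        frob_norm_nonneg[of P] by (metis of_nat_le_iff real_le_rsqrt)
    \<comment> \<open>\<open>c\<close> is the exact projection cost, not the additive constant of
      the sketch, which is 0. \<open>h\<close> is the head's share of it, while \<open>t\<close> is
      the energy of the whole tail, before projection.\<close>
    define c where "c = mat_inner (Y * A) (Y * A)"
    define h where "h = mat_inner (Y * H) (Y * H)"
    define t where "t = mat_inner T T"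
    have YH: "Y * H = Y * A * W * transpose_mat W"
      unfolding HW using Y A W by (simp add: assoc_mult_mat_dim)
    have h_AW: "h = mat_inner (Y * A * W) (Y * A * W)"
      unfolding h_def YH by (rule mat_inner_mult_orthonormal_cols[OF _ W WW]) (use Y A W in auto)
    have Tsplit: "T = A - A * W * transpose_mat W" unfolding TH HW ..
    \<comment> \<open>Here t = |A|^2 - |A W|^2 and c = |A|^2 - |P A|^2, and \<open>P\<close>
      captures at most the energy of \<open>A * W\<close>.\<close>
    have t_le: "t \<le> c"
      using orthonormal_cols_pythagoras[OF A W WW, folded Tsplit]
        svd_first_cols_energy[OF A svd k(2), folded W_def]
        svd_projection_energy_le[OF A svd k(2) P rank] Pyth[OF A]
      unfolding t_def c_def by simp
    have YT: "Y * T = Y * A - Y * A * W * transpose_mat W"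
      using mult_minus_distrib_mat[OF Y A H] YH unfolding TH by simp
    have "mat_inner (Y * T) (Y * T) = c - h"
      unfolding YT c_def h_AW by (rule orthonormal_cols_pythagoras[OF _ W WW]) (use Y A in auto)
    then have yt: "mat_inner (Y * T) (Y * T) = c - h" and h_le: "h \<le> c"
      using mat_inner_self_nonneg[of "Y * T"] by auto
    have h0: "0 \<le> h" and t0: "0 \<le> t" unfolding h_def t_def by (rule mat_inner_self_nonneg)+

    have TS: "T * S \<in> carrier_mat n m" and HS: "H * S \<in> carrier_mat n m" using T H S by auto
    have embed: "\<bar>h - mat_inner (Y * H * S) (Y * H * S)\<bar> \<le> \<epsilon> / 3 * h"
      unfolding h_def
      by (rule subspace_embedding_mat_inner[OF embedding[folded H_def] H S Y])

    have tail: "\<bar>mat_inner (Y * (T * S)) (Y * (T * S)) - (c - h)\<bar> \<le> \<epsilon> / 3 * t"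
    proof -
      \<comment> \<open>This makes the squared norm linear in the Gram matrix of \<open>M\<close>,
        so the difference between \<open>T\<close> and \<open>T * S\<close> becomes a pairing of
        \<open>P\<close> with \<open>K\<close>.\<close>
      have PM: "mat_inner (P * M) (P * M) = mat_inner P (M * transpose_mat M)"
        if M: "M \<in> carrier_mat n q" for M q
      proof -
        have "mat_inner (P * M) (P * M) = mat_inner (P * M) M"
          using mat_inner_mult_left[OF Pc M, of "P * M"] mat_inner_commute[of M n q "P * M"]
            Pc M sym idem by (simp flip: assoc_mult_mat[OF Pc Pc M])
        then show ?thesis using mat_inner_mult_right[OF Pc M M] by simp
      qed
      have "T * S * transpose_mat (T * S) = T * S * transpose_mat S * transpose_mat T"
        using T S transpose_mult[OF T S] by (simp add: assoc_mult_mat_dim)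
      moreover have "T * transpose_mat T \<in> carrier_mat n n"
        and "T * S * transpose_mat S * transpose_mat T \<in> carrier_mat n n"
        using T by (auto intro!: carrier_matI)
      ultimately
      have "mat_inner (P * T) (P * T) - mat_inner (P * (T * S)) (P * (T * S)) = mat_inner P K"
        unfolding PM[OF T] PM[OF TS] K_def by (simp only: mat_inner_diff_right[OF Pc])
      moreover have "\<bar>mat_inner P K\<bar> \<le> \<epsilon> / 6 * t"
      proof -
        have "\<bar>mat_inner P K\<bar> \<le> frob_norm P * frob_norm K"
          by (rule mat_inner_Cauchy_Schwarz[OF Pc K])
        also have "\<dots> \<le> sqrt (real k) * (\<epsilon> / (6 * sqrt (real k)) * (frob_norm T)\<^sup>2)"
          by (intro mult_mono fP fK frob_norm_nonneg) (use sqrtk in auto)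
        also have "\<dots> = \<epsilon> / 6 * t" using sqrtk unfolding frob_norm_square t_def by simp
        finally show ?thesis .
      qed
      \<comment> \<open>The norm preservation error and the pairing with \<open>K\<close> contribute
        \<epsilon> / 6 * t each.\<close>
      ultimately show ?thesis
        using fT unfolding Pyth[OF TS] yt[symmetric] Pyth[OF T] t_def[symmetric]
        by linarith
    qed

    have cross: "\<bar>mat_inner (Y * H * S) (Y * (T * S))\<bar> \<le> \<epsilon> / 6 * c"
    proof -
      have "mat_inner (Y * H * S) (Y * (T * S))
          = mat_inner (Y * A * W * (transpose_mat W * S)) (Y * (T * S))"
        unfolding YH using Y A W S by (simp add: assoc_mult_mat_dim)
      also have "\<dots> = mat_inner (Y * A * W) (Y * (T * S) * transpose_mat (transpose_mat W * S))"
        by (rule mat_inner_mult_right) (use Y A W S T in auto)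
      also have "Y * (T * S) * transpose_mat (transpose_mat W * S) = Y * G"
        unfolding G_def using Y T S W transpose_mult[of "transpose_mat W" k d S m]
        by (simp add: assoc_mult_mat_dim)
      also have "mat_inner (Y * A * W) (Y * G) = mat_inner (Y * (A * W)) (Y * G)"
        using Y A W by (simp add: assoc_mult_mat_dim)
      also have "\<dots> = mat_inner (A * W) (transpose_mat Y * (Y * G))"
        by (rule mat_inner_mult_left) (use Y A W G in auto)
      \<comment> \<open>One copy of \<open>Y\<close> is absorbed, so that Cauchy-Schwarz meets
        \<open>G\<close> rather than \<open>Y * G\<close>.\<close>
      also have "transpose_mat Y * (Y * G) = transpose_mat Y * G"
        unfolding Yt using assoc_mult_mat[OF Y Y G] YY by simp
      also have "mat_inner (A * W) (transpose_mat Y * G) = mat_inner (Y * (A * W)) G"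
        by (rule mat_inner_mult_left[symmetric]) (use Y A W G in auto)
      also have "Y * (A * W) = Y * A * W" using Y A W by simp
      finally have "\<bar>mat_inner (Y * H * S) (Y * (T * S))\<bar> \<le> frob_norm (Y * A * W) * frob_norm G"
        using mat_inner_Cauchy_Schwarz[of "Y * A * W" n k G] Y A W G by simp
      also have "\<dots> \<le> sqrt c * (\<epsilon> / 6 * sqrt c)"
      proof (intro mult_mono frob_norm_nonneg)
        show "frob_norm (Y * A * W) \<le> sqrt c"
          using h_le unfolding h_AW frob_norm_square[symmetric] by (rule real_le_rsqrt)
        have "frob_norm T \<le> sqrt c"
          using t_le unfolding t_def frob_norm_square[symmetric] by (rule real_le_rsqrt)
        then show "frob_norm G \<le> \<epsilon> / 6 * sqrt c"
          using fG eps by (smt (verit) mult_left_mono divide_pos_pos)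
      qed (use h0 h_le in auto)
      also have "\<dots> = \<epsilon> / 6 * c" using h0 h_le by simp
      finally show ?thesis .
    qed

    have "Y * (A * S) = Y * H * S + Y * (T * S)"
      unfolding AHT using Y H T S
      by (simp add: add_mult_distrib_mat[OF H T S] mult_add_distrib_mat[OF Y HS TS])
    then have split: "mat_inner (Y * (A * S)) (Y * (A * S))
        = mat_inner (Y * H * S) (Y * H * S) + 2 * mat_inner (Y * H * S) (Y * (T * S))
          + mat_inner (Y * (T * S)) (Y * (T * S))"
      using mat_inner_add_self[of "Y * H * S" n m "Y * (T * S)"] Y H T S by simp
    \<comment> \<open>The budget is \<epsilon> / 3 for the head, twice \<epsilon> / 6 for the cross
      term and \<epsilon> / 3 for the tail, all relative to \<open>c\<close>.\<close>
    have "\<epsilon> / 3 * h \<le> \<epsilon> / 3 * c" "\<epsilon> / 3 * t \<le> \<epsilon> / 3 * c"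
      using h_le t_le eps by (simp_all add: mult_left_mono)
    then have "\<bar>mat_inner (Y * (A * S)) (Y * (A * S)) - c\<bar> \<le> \<epsilon> * c"
      using embed tail cross unfolding split abs_le_iff by (intro conjI) argo+
    then show ?thesis
      using A S unfolding frob_norm_square YM[OF A, symmetric] c_def[symmetric]
        YM[of "A * S" m, symmetric, OF mult_carrier_mat[OF A S]]
      by (simp add: algebra_simps abs_le_iff)
  qed
  then show ?thesis
    using A S unfolding projection_cost_preserving_sketch_def by auto
qed

end
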